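(* Let $K$ be a field, let $P=K[x_1,\dots,x_n]$, let $\mathfrak{M}=\langle x_1,\dots,x_n\rangle$, let $1\le s\le n$, and let $Z=(z_1,\dots,z_s)$ be a tuple of pairwise distinct indeterminates in $\{x_1,\dots,x_n\}$. Let $f_1,\dots,f_s\in\mathfrak{M}\setminus\{0\}$, let $F=(f_1,\dots,f_s)$, and assume that $z_i\in\mathrm{Supp}(f_i)$ for $i=1,\dots,s$. Let $\mathrm{DLog}_Z(F)=\{v_1,\dots,v_k\}$ and write $v_i=(v_{i1},\dots,v_{in})$ with $v_{ij}\in\mathbb{Z}$ for $i=1,\dots,k$. Let $A=(a_{ij})\in\mathrm{Mat}_{k,n}(\mathbb{Q})$, where $a_{ij}=-v_{ij}$, and let $b=(b_1,\dots,b_k)$, where $b_i=v_{i1}+\cdots+v_{in}-1$ for $i=1,\dots,k$. Then the following conditions are equivalent. (a) The tuple $F$ is $Z$-separating. (b) The linear programming feasibility problem in standard form given by $A\xi\le b$ and $\xi\ge 0$ has a solution $\xi=(\xi_1,\dots,\xi_n)\in\mathbb{Q}^n$. If these conditions are satisfied and $\xi$ is such a solution, let $\tilde u_i=\xi_i+1$ for $i=1,\dots,n$ and multiply the numbers $\tilde u_i\in\mathbb{Q}_+$ by their common denominator to get $u_i\in\mathbb{N}_+$. Then the vector $u=(u_1,\dots,u_n)\in\mathbb{N}_+^n$ satisfies $u\cdot v>0$ for all $v\in\mathrm{DLog}_Z(F)$.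
   Context: $\mathbb{N}_+$ is the set of positive integers, $\mathbb{Q}_+$ the set of positive rationals, and $u\cdot v$ is the dot product. A term is a power product $t=x_1^{\alpha_1}\cdots x_n^{\alpha_n}$, and $\log(t)=(\alpha_1,\dots,\alpha_n)$. $\mathrm{Supp}(f)$ is the set of terms occurring in $f$ with nonzero coefficient. For a term ordering $\sigma$ (a multiplicative total well-ordering on terms), $\mathrm{LT}_\sigma(f)$ is the $\sigma$-largest term in $\mathrm{Supp}(f)$. The tuple $F$ is $Z$-separating if there is a term ordering $\sigma$ with $\mathrm{LT}_\sigma(f_i)=z_i$ for $i=1,\dots,s$. $\mathrm{DLog}_{z_i}(f_i)=\{\log(z_i)-\log(t)\mid t\in\mathrm{Supp}(f_i)\setminus\{z_i\}\}$ and $\mathrm{DLog}_Z(F)=\bigcup_{i=1}^s\mathrm{DLog}_{z_i}(f_i)\subseteq\mathbb{Z}^n$. The inequalities $A\xi\le b$ and $\xi\ge 0$ are understood componentwise, i.e., $a_{i1}\xi_1+\cdots+a_{in}\xi_n\le b_i$ for $i=1,\dots,k$ and $\xi_j\ge 0$ for $j=1,\dots,n$. *)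

theory Defs
  imports "HOL-Library.Poly_Mapping" "Jordan_Normal_Form.Matrix"
begin

text \<open>
  A term \<open>x\<^sub>1\<^bsup>\<alpha>\<^sub>1\<^esup> \<cdots> x\<^sub>n\<^bsup>\<alpha>\<^sub>n\<^esup>\<close> is represented by its exponent function, so terms are multiplied
  by \<open>+\<close> and the term \<open>1\<close> is \<open>0\<close>.  Indices start at \<open>0\<close>: the indeterminates of \<open>K[x\<^sub>1, \<dots>, x\<^sub>n]\<close> are
  \<open>indet 0, \<dots>, indet (n - 1)\<close>.  Multiplication of polynomials is the convolution product of
  Poly_Mapping, and \<open>polys n\<close> is the subring of the polynomials in the first \<open>n\<close> indeterminates.
\<close>

type_synonym pprod = "nat \<Rightarrow>\<^sub>0 nat"
type_synonym 'a mpol = "pprod \<Rightarrow>\<^sub>0 'a"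

abbreviation Supp :: "'a::zero mpol \<Rightarrow> pprod set" where
  "Supp f \<equiv> Poly_Mapping.keys f"

definition pprods :: "nat \<Rightarrow> pprod set" where
  "pprods n = {t. Poly_Mapping.keys t \<subseteq> {..<n}}"

definition polys :: "nat \<Rightarrow> 'a::comm_ring_1 mpol set" where
  "polys n = {f. Supp f \<subseteq> pprods n}"

definition indet :: "nat \<Rightarrow> pprod" where
  "indet j = Poly_Mapping.single j 1"

text \<open>The ideal of \<open>polys n\<close> generated by all \<open>n\<close> indeterminates.\<close>

definition irrelevant_ideal :: "nat \<Rightarrow> 'a::comm_ring_1 mpol set" where
  "irrelevant_ideal n =
     {\<Sum>j<n. g j * Poly_Mapping.single (indet j) 1 | g. \<forall>j<n. g j \<in> polys n}"

text \<open>\<open>(t, t') \<in> \<sigma>\<close> means \<open>t \<le> t'\<close>.\<close>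

definition term_ordering :: "nat \<Rightarrow> pprod rel \<Rightarrow> bool" where
  "term_ordering n \<sigma> \<longleftrightarrow> well_order_on (pprods n) \<sigma> \<and>
     (\<forall>t\<in>pprods n. \<forall>t'\<in>pprods n. \<forall>r\<in>pprods n. (t, t') \<in> \<sigma> \<longrightarrow> (t + r, t' + r) \<in> \<sigma>)"

definition leading_term :: "pprod rel \<Rightarrow> 'a::zero mpol \<Rightarrow> pprod" where
  "leading_term \<sigma> f = (THE t. t \<in> Supp f \<and> (\<forall>t'\<in>Supp f. (t', t) \<in> \<sigma>))"

definition separating :: "nat \<Rightarrow> pprod list \<Rightarrow> 'a::zero mpol list \<Rightarrow> bool" where
  "separating n Z F \<longleftrightarrow>
     (\<exists>\<sigma>. term_ordering n \<sigma> \<and> (\<forall>i<length Z. leading_term \<sigma> (F ! i) = Z ! i))"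

definition exponent_vec :: "nat \<Rightarrow> pprod \<Rightarrow> int vec" where
  "exponent_vec n t = vec n (\<lambda>j. int (Poly_Mapping.lookup t j))"

definition DLog1 :: "nat \<Rightarrow> pprod \<Rightarrow> 'a::zero mpol \<Rightarrow> int vec set" where
  "DLog1 n z f = {exponent_vec n z - exponent_vec n t | t. t \<in> Supp f - {z}}"

definition DLog :: "nat \<Rightarrow> pprod list \<Rightarrow> 'a::zero mpol list \<Rightarrow> int vec set" where
  "DLog n Z F = (\<Union>i<length Z. DLog1 n (Z ! i) (F ! i))"

definition lp_solution :: "rat mat \<Rightarrow> rat vec \<Rightarrow> rat vec \<Rightarrow> bool" where
  "lp_solution A b \<xi> \<longleftrightarrow>
     \<xi> \<in> carrier_vec (dim_col A) \<and> A *\<^sub>v \<xi> \<le> b \<and> 0\<^sub>v (dim_col A) \<le> \<xi>"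

definition common_denominator :: "int \<Rightarrow> rat vec \<Rightarrow> bool" where
  "common_denominator d w \<longleftrightarrow> d > 0 \<and> (\<forall>i<dim_vec w. snd (quotient_of (w $ i)) dvd d)"

end

theory Submission
  imports Defs
begin

text \<open>
  After the substitution \<open>w = \<xi> + 1\<close> the linear programme asks for a rational vector \<open>w\<close> with all
  \<open>w\<^sub>j \<ge> 1\<close> and \<open>w \<cdot> y \<ge> 1\<close> for every \<open>y \<in> DLog\<^sub>Z(F)\<close> (lemma \<open>lp_solution_iff\<close>); up to scaling, this
  is a system of positive weights for the indeterminates under which each \<open>z\<^sub>i\<close> is heavier than
  every other term of \<open>f\<^sub>i\<close>.

  Given such weights, comparing terms by weight and breaking ties by a fixed linear order that is
  compatible with multiplication is a term ordering (lemma \<open>term_ordering_weight_order\<close>):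
  positivity of the weights leaves only finitely many terms below each term.  It has the required
  leading terms.

  Conversely, for a term ordering \<open>\<sigma>\<close> the vectors \<open>log a - log b\<close> with \<open>b <\<^sub>\<sigma> a\<close> form a set that is
  closed under addition and does not contain \<open>0\<close>.  By a form of Gordan's theorem (lemma
  \<open>exists_positive_functional\<close>, proved by Fourier--Motzkin elimination), each finite subset of it
  lies in an open half-space bounded by a rational hyperplane through the origin.  The subset to use
  consists of \<open>DLog\<^sub>Z(F)\<close> and the unit vectors, which belong to the set because \<open>1\<close> is the least
  term.
\<close>

section \<open>A rational theorem of the alternative\<close>

lemma finite_sets_separated:
  fixes L H :: "'a :: {unbounded_dense_linorder} set"
  assumes "finite L" "finite H" and lt: "\<And>l h. l \<in> L \<Longrightarrow> h \<in> H \<Longrightarrow> l < h"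
  shows "\<exists>x. (\<forall>l\<in>L. l < x) \<and> (\<forall>h\<in>H. x < h)"
proof (cases "L = {}")
  case True
  obtain x where "\<forall>h\<in>H. x < h"
    using lt_ex[of "Min H"] \<open>finite H\<close> by (cases "H = {}") auto
  then show ?thesis using True by blast
next
  case False
  then have L: "\<And>l. l \<in> L \<Longrightarrow> l \<le> Max L" "Max L \<in> L" using \<open>finite L\<close> by auto
  show ?thesis
  proof (cases "H = {}")
    case True
    then show ?thesis using gt_ex[of "Max L"] L(1) le_less_trans by blast
  next
    case False
    then have H: "\<And>h. h \<in> H \<Longrightarrow> Min H \<le> h" "Min H \<in> H" using \<open>finite H\<close> by auto
    obtain x where "Max L < x" "x < Min H" using dense lt[OF L(2) H(2)] by blast
    then show ?thesis using L(1) H(1) le_less_trans less_le_trans by blast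
  qed
qed

lemma add_closed_scale:
  fixes C :: "(nat \<Rightarrow> int) set"
  assumes add: "\<And>x y. x \<in> C \<Longrightarrow> y \<in> C \<Longrightarrow> (\<lambda>j. x j + y j) \<in> C"
    and "x \<in> C" "m > 0"
  shows "(\<lambda>j. m * x j) \<in> C"
proof -
  have "1 \<le> m" using \<open>m > 0\<close> by simp
  then show ?thesis
  proof (induction m rule: int_ge_induct)
    case base
    then show ?case using \<open>x \<in> C\<close> by simp
  next
    case (step m)
    have "(\<lambda>j. (m + 1) * x j) = (\<lambda>j. m * x j + x j)" by (simp add: algebra_simps)
    then show ?case using add[OF step.IH \<open>x \<in> C\<close>] by simp
  qed
qed

text \<open>
  In Gordan's theorem, the alternative to the conclusion is that some nontrivial nonnegative
  combination of \<open>V\<close> vanishes.  A set \<open>C \<supseteq> V\<close> that is closed under addition and does not contain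
  \<open>0\<close> excludes this, and the elimination of a coordinate passes to such a set again.  Vectors are
  functions on \<open>nat\<close> of which only the first \<open>n\<close> coordinates matter.
\<close>

lemma exists_positive_functional:
  fixes C V :: "(nat \<Rightarrow> int) set"
  assumes add: "\<And>x y. x \<in> C \<Longrightarrow> y \<in> C \<Longrightarrow> (\<lambda>j. x j + y j) \<in> C"
    and nonzero: "\<And>x. x \<in> C \<Longrightarrow> \<exists>j<n. x j \<noteq> 0"
    and "finite V" "V \<subseteq> C"
  shows "\<exists>u :: nat \<Rightarrow> rat. \<forall>x\<in>V. 0 < (\<Sum>j<n. u j * of_int (x j))"
  using assms
proof (induction n arbitrary: C V)
  case 0
  have "V = {}" using "0.prems"(2,4) by blast
  then show ?case by simp
next
  case (Suc n)
  define C' where "C' = {x \<in> C. x n = 0}"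
  define P where "P = {x \<in> V. 0 < x n}"
  define N where "N = {x \<in> V. x n < 0}"
  \<comment> \<open>the positive combination of \<open>p\<close> and \<open>q\<close> in which coordinate \<open>n\<close> cancels\<close>
  define comb where "comb p q = (\<lambda>j. p n * q j + (- q n) * p j)" for p q :: "nat \<Rightarrow> int"
  define V' where "V' = {x \<in> V. x n = 0} \<union> case_prod comb ` (P \<times> N)"
  have fin: "finite P" "finite N" using \<open>finite V\<close> by (simp_all add: P_def N_def)
  have comb_C': "comb p q \<in> C'" if "p \<in> P" "q \<in> N" for p q
  proof -
    have "p \<in> C" "q \<in> C" "0 < p n" "0 < - q n"
      using that \<open>V \<subseteq> C\<close> by (auto simp: P_def N_def)
    then have "comb p q \<in> C"
      unfolding comb_def by (intro Suc.prems(1) add_closed_scale[OF Suc.prems(1)])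
    then show ?thesis by (simp add: C'_def comb_def)
  qed
  have "\<exists>u :: nat \<Rightarrow> rat. \<forall>x\<in>V'. 0 < (\<Sum>j<n. u j * of_int (x j))"
  proof (rule Suc.IH[of C'])
    show "(\<lambda>j. x j + y j) \<in> C'" if "x \<in> C'" "y \<in> C'" for x y
      using that Suc.prems(1) by (simp add: C'_def)
    show "\<exists>j<n. x j \<noteq> 0" if "x \<in> C'" for x
      using that Suc.prems(2)[of x] by (auto simp: C'_def less_Suc_eq)
    show "finite V'" using fin \<open>finite V\<close> by (simp add: V'_def)
    show "V' \<subseteq> C'" using comb_C' \<open>V \<subseteq> C\<close> by (auto simp: V'_def C'_def)
  qed
  then obtain u :: "nat \<Rightarrow> rat" where u: "\<And>x. x \<in> V' \<Longrightarrow> 0 < (\<Sum>j<n. u j * of_int (x j))"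
    by blast
  define S where "S x = (\<Sum>j<n. u j * of_int (x j))" for x
  have "\<exists>c. (\<forall>l \<in> (\<lambda>p. - S p / of_int (p n)) ` P. l < c) \<and>
            (\<forall>h \<in> (\<lambda>q. - S q / of_int (q n)) ` N. c < h)"
  proof (rule finite_sets_separated)
    fix l h
    assume "l \<in> (\<lambda>p. - S p / of_int (p n)) ` P" "h \<in> (\<lambda>q. - S q / of_int (q n)) ` N"
    then obtain p q where p: "p \<in> P" "l = - S p / of_int (p n)"
      and q: "q \<in> N" "h = - S q / of_int (q n)" by blast
    have sgn: "(of_int (p n) :: rat) > 0" "(of_int (q n) :: rat) < 0"
      using p q by (simp_all add: P_def N_def)
    have "0 < S (comb p q)"
      unfolding S_def using u[of "comb p q"] p(1) q(1) by (force simp: V'_def)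
    also have "S (comb p q) = of_int (p n) * S q - of_int (q n) * S p"
      by (simp add: S_def comb_def sum_distrib_left sum_subtractf[symmetric] algebra_simps)
    finally show "l < h"
      using sgn by (simp add: p q field_simps)
  qed (use fin in auto)
  then obtain c where cP: "\<And>p. p \<in> P \<Longrightarrow> - S p / of_int (p n) < c"
    and cN: "\<And>q. q \<in> N \<Longrightarrow> c < - S q / of_int (q n)" by blast
  have "0 < S x + c * of_int (x n)" if "x \<in> V" for x
  proof (cases "x n" "0 :: int" rule: linorder_cases)
    case less
    then have "x \<in> N" "(of_int (x n) :: rat) < 0" using that by (simp_all add: N_def)
    then show ?thesis using cN[of x] by (simp add: field_simps)
  next
    case equal
    then show ?thesis using u[of x] that by (simp add: V'_def S_def)
  next
    case greater
    then have "x \<in> P" "(of_int (x n) :: rat) > 0" using that by (simp_all add: P_def)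
    then show ?thesis using cP[of x] by (simp add: field_simps)
  qed
  moreover have "(\<Sum>j<Suc n. (u(n := c)) j * of_int (x j)) = S x + c * of_int (x n)" for x
    by (simp add: S_def)
  ultimately show ?case by metis
qed

section \<open>Term orderings and weights\<close>

text \<open>The weighted degree of a term, that is, the dot product of \<open>(w\<^sub>1, \<dots>, w\<^sub>n)\<close> with \<open>log t\<close>.\<close>

definition weight :: "nat \<Rightarrow> (nat \<Rightarrow> rat) \<Rightarrow> pprod \<Rightarrow> rat" where
  "weight n w t = (\<Sum>j<n. w j * of_nat (Poly_Mapping.lookup t j))"

lemma weight_add: "weight n w (t + t') = weight n w t + weight n w t'"
  by (simp add: weight_def lookup_add algebra_simps sum.distrib)

lemma weight_0 [simp]: "weight n w 0 = 0"
  by (simp add: weight_def)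

lemma weight_indet:
  assumes "j < n"
  shows "weight n w (indet j) = w j"
proof -
  have "weight n w (indet j) = (\<Sum>i<n. if i = j then w i else 0)"
    unfolding weight_def indet_def by (intro sum.cong) (auto simp: lookup_single when_def)
  then show ?thesis using assms by simp
qed

lemma pprods_0: "0 \<in> pprods n"
  by (simp add: pprods_def)

lemma pprods_add: "t \<in> pprods n \<Longrightarrow> t' \<in> pprods n \<Longrightarrow> t + t' \<in> pprods n"
  using keys_add[of t t'] by (auto simp: pprods_def)

lemma indet_in_pprods: "j < n \<Longrightarrow> indet j \<in> pprods n"
  by (simp add: pprods_def indet_def)

lemma lookup_pprods: "t \<in> pprods n \<Longrightarrow> \<not> j < n \<Longrightarrow> Poly_Mapping.lookup t j = 0"
  by (auto simp: pprods_def in_keys_iff)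

lemma finite_weight_le:
  assumes w: "\<And>j. j < n \<Longrightarrow> 0 < w j"
  shows "finite {t \<in> pprods n. weight n w t \<le> c}" (is "finite ?S")
proof -
  define m where "m = (\<Sum>j<n. nat \<lfloor>c / w j\<rfloor>)"
  have "Poly_Mapping.lookup t j \<le> m" if "t \<in> ?S" "j < n" for t j
  proof -
    have "w j * of_nat (Poly_Mapping.lookup t j) \<le> weight n w t"
      unfolding weight_def
      by (rule member_le_sum) (use w \<open>j < n\<close> in \<open>auto simp: less_imp_le\<close>)
    also have "\<dots> \<le> c" using that by simp
    finally have "of_nat (Poly_Mapping.lookup t j) \<le> c / w j"
      using w[OF \<open>j < n\<close>] by (simp add: field_simps)
    then have "Poly_Mapping.lookup t j \<le> nat \<lfloor>c / w j\<rfloor>"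
      by (metis le_nat_iff le_floor_iff nat_0_le of_nat_0_le_iff of_int_of_nat_eq order_trans
          zero_le_floor)
    also have "\<dots> \<le> m"
      unfolding m_def by (rule member_le_sum) (use \<open>j < n\<close> in auto)
    finally show ?thesis .
  qed
  then have "Poly_Mapping.lookup ` ?S
      \<subseteq> {f. \<forall>j. (j \<in> {..<n} \<longrightarrow> f j \<in> {..m}) \<and> (j \<notin> {..<n} \<longrightarrow> f j = 0)}"
    using lookup_pprods by auto
  then have "finite (Poly_Mapping.lookup ` ?S)"
    by (rule finite_subset) (intro finite_set_of_finite_funs finite_lessThan finite_atMost)
  then show ?thesis
    by (rule finite_imageD) (simp add: inj_on_def poly_mapping_eqI)
qed

text \<open>
  Terms compared by weight; ties are broken by the linear order on exponent functions that belongs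
  to the type of terms, which is compatible with multiplication.
\<close>

definition weight_order :: "nat \<Rightarrow> (nat \<Rightarrow> rat) \<Rightarrow> pprod rel" where
  "weight_order n w = {(t, t'). t \<in> pprods n \<and> t' \<in> pprods n \<and>
     (weight n w t < weight n w t' \<or> weight n w t = weight n w t' \<and> t \<le> t')}"

lemma term_ordering_weight_order:
  assumes w: "\<And>j. j < n \<Longrightarrow> 0 < w j"
  shows "term_ordering n (weight_order n w)"
proof -
  let ?\<sigma> = "weight_order n w"
  have "wf (?\<sigma> - Id)"
  proof (rule wf_finite_segments)
    show "irrefl (?\<sigma> - Id)" by (simp add: irrefl_def)
    show "trans (?\<sigma> - Id)" by (rule transI) (auto simp: weight_order_def)
    show "finite {t. (t, t') \<in> ?\<sigma> - Id}" for t'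
      by (rule finite_subset[OF _ finite_weight_le[of n w "weight n w t'"]])
        (use w in \<open>auto simp: weight_order_def\<close>)
  qed
  moreover have "linear_order_on (pprods n) ?\<sigma>"
    unfolding order_on_defs refl_on_def trans_def antisym_def total_on_def
    by (auto simp: weight_order_def)
  ultimately have "well_order_on (pprods n) ?\<sigma>" by (simp add: well_order_on_def)
  then show ?thesis
    unfolding term_ordering_def
    by (auto simp: weight_order_def weight_add pprods_add add_right_mono)
qed

lemma term_ordering_linear:
  "term_ordering n \<sigma> \<Longrightarrow> linear_order_on (pprods n) \<sigma>"
  by (simp add: term_ordering_def well_order_on_def)

lemma term_ordering_antisym:
  "term_ordering n \<sigma> \<Longrightarrow> (t, t') \<in> \<sigma> \<Longrightarrow> (t', t) \<in> \<sigma> \<Longrightarrow> t = t'"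
  using term_ordering_linear by (auto simp: order_on_defs antisym_def)

lemma term_ordering_trans:
  "term_ordering n \<sigma> \<Longrightarrow> (t, t') \<in> \<sigma> \<Longrightarrow> (t', t'') \<in> \<sigma> \<Longrightarrow> (t, t'') \<in> \<sigma>"
  using term_ordering_linear by (auto simp: order_on_defs dest: transD)

lemma term_ordering_add:
  "term_ordering n \<sigma> \<Longrightarrow> (t, t') \<in> \<sigma> \<Longrightarrow> r \<in> pprods n \<Longrightarrow> (t + r, t' + r) \<in> \<sigma>"
  using term_ordering_linear[of n \<sigma>] by (auto simp: term_ordering_def order_on_defs)

lemma term_ordering_zero_least:
  assumes \<sigma>: "term_ordering n \<sigma>" and t: "t \<in> pprods n"
  shows "(0, t) \<in> \<sigma>"
proof -
  have "wf (\<sigma> - Id)" using \<sigma> by (simp add: term_ordering_def well_order_on_def)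
  then obtain m where m: "m \<in> pprods n" "\<And>r. (r, m) \<in> \<sigma> - Id \<Longrightarrow> r \<notin> pprods n"
    using wfE_min[of "\<sigma> - Id" 0 "pprods n"] pprods_0 by blast
  have "t = 0" if "(t, 0) \<in> \<sigma>"
  proof -
    \<comment> \<open>otherwise \<open>t \<cdot> m\<close> would be smaller than the least term \<open>m\<close>\<close>
    have "(t + m, m) \<in> \<sigma>" using term_ordering_add[OF \<sigma> that m(1)] by simp
    then have "t + m = m" using m(2) pprods_add[OF t m(1)] by blast
    then show "t = 0" by simp
  qed
  then show ?thesis
    using term_ordering_linear[OF \<sigma>] t pprods_0[of n]
    by (cases "t = 0") (auto simp: order_on_defs total_on_def refl_on_def)
qed

text \<open>
  On each finite set of strict comparisons, a term ordering is realized by positive rational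
  weights.
\<close>

lemma term_ordering_weights:
  assumes \<sigma>: "term_ordering n \<sigma>" and fin: "finite R" and R: "R \<subseteq> \<sigma> - Id"
  shows "\<exists>w. (\<forall>j<n. 1 \<le> w j) \<and> (\<forall>(t, t')\<in>R. 1 \<le> weight n w t' - weight n w t)"
proof -
  define dlog :: "pprod \<times> pprod \<Rightarrow> nat \<Rightarrow> int" where
    "dlog = (\<lambda>(t, t') j. int (Poly_Mapping.lookup t' j) - int (Poly_Mapping.lookup t j))"
  have weight_dlog:
    "(\<Sum>j<n. u j * of_int (dlog (t, t') j)) = weight n u t' - weight n u t" for u t t'
    by (simp add: dlog_def weight_def sum_subtractf right_diff_distrib)
  have sub: "t \<in> pprods n \<and> t' \<in> pprods n" if "(t, t') \<in> \<sigma>" for t t'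
    using that term_ordering_linear[OF \<sigma>] by (auto simp: order_on_defs)
  define R' where "R' = R \<union> (\<lambda>j. (0, indet j)) ` {..<n}"
  have "(0, indet j) \<in> \<sigma> - Id" if "j < n" for j
    using term_ordering_zero_least[OF \<sigma> indet_in_pprods[OF that]]
    by (auto simp: indet_def dest: arg_cong[of _ _ Poly_Mapping.keys])
  then have R': "finite R'" "R' \<subseteq> \<sigma> - Id" using fin R by (auto simp: R'_def)
  have "\<exists>u :: nat \<Rightarrow> rat. \<forall>x\<in>dlog ` R'. 0 < (\<Sum>j<n. u j * of_int (x j))"
  proof (rule exists_positive_functional)
    fix x y assume "x \<in> dlog ` (\<sigma> - Id)" "y \<in> dlog ` (\<sigma> - Id)"
    then obtain a a' b b' where a: "(a, a') \<in> \<sigma>" "a \<noteq> a'" "x = dlog (a, a')"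
      and b: "(b, b') \<in> \<sigma>" "b \<noteq> b'" "y = dlog (b, b')" by auto
    have 1: "(a + b, a' + b) \<in> \<sigma>" using term_ordering_add[OF \<sigma> a(1)] sub[OF b(1)] by blast
    have 2: "(a' + b, a' + b') \<in> \<sigma>"
      using term_ordering_add[OF \<sigma> b(1), of a'] sub[OF a(1)] by (simp add: add.commute)
    have "a + b \<noteq> a' + b'"
      using term_ordering_antisym[OF \<sigma> 1] 2 a(2) by auto
    then have "(a + b, a' + b') \<in> \<sigma> - Id" using term_ordering_trans[OF \<sigma> 1 2] by simp
    moreover have "(\<lambda>j. x j + y j) = dlog (a + b, a' + b')"
      by (simp add: a b dlog_def lookup_add fun_eq_iff)
    ultimately show "(\<lambda>j. x j + y j) \<in> dlog ` (\<sigma> - Id)" by blast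
  next
    fix x assume "x \<in> dlog ` (\<sigma> - Id)"
    then obtain a a' where a: "(a, a') \<in> \<sigma>" "a \<noteq> a'" "x = dlog (a, a')" by auto
    show "\<exists>j<n. x j \<noteq> 0"
    proof (rule ccontr)
      assume "\<not> (\<exists>j<n. x j \<noteq> 0)"
      then have "Poly_Mapping.lookup a j = Poly_Mapping.lookup a' j" for j
        using lookup_pprods[of a n j] lookup_pprods[of a' n j] sub[OF a(1)]
        by (cases "j < n") (auto simp: a(3) dlog_def)
      then show False using a(2) by (simp add: poly_mapping_eqI)
    qed
  qed (use R' in auto)
  then obtain u where u: "\<And>t t'. (t, t') \<in> R' \<Longrightarrow> 0 < weight n u t' - weight n u t"
    using weight_dlog by force
  \<comment> \<open>rescale so that the finitely many positive values become at least \<open>1\<close>\<close>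
  define c where "c = (\<Sum>(t, t')\<in>R'. 1 / (weight n u t' - weight n u t))"
  define w where "w j = c * u j" for j
  have weight_w: "weight n w t = c * weight n u t" for t
    by (simp add: weight_def w_def sum_distrib_left mult.assoc)
  have ge1: "1 \<le> weight n w t' - weight n w t" if "(t, t') \<in> R'" for t t'
  proof -
    have "(case (t, t') of (t, t') \<Rightarrow> 1 / (weight n u t' - weight n u t)) \<le> c"
      unfolding c_def by (rule member_le_sum) (use that u R'(1) in \<open>auto intro: less_imp_le\<close>)
    then show ?thesis using u[OF that] by (simp add: weight_w field_simps)
  qed
  have "1 \<le> w j" if "j < n" for j
    using ge1[of 0 "indet j"] weight_indet[OF that] that by (auto simp: R'_def)
  moreover have "\<forall>(t, t')\<in>R. 1 \<le> weight n w t' - weight n w t"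
    using ge1 by (auto simp: R'_def)
  ultimately show ?thesis by blast
qed

section \<open>Leading terms and separating tuples\<close>

lemma leading_term_eq_iff:
  assumes \<sigma>: "term_ordering n \<sigma>" and f: "Supp f \<subseteq> pprods n" "z \<in> Supp f"
  shows "leading_term \<sigma> f = z \<longleftrightarrow> (\<forall>t\<in>Supp f. (t, z) \<in> \<sigma>)"
proof -
  note lin = term_ordering_linear[OF \<sigma>]
  have "\<exists>m\<in>S. \<forall>t\<in>S. (t, m) \<in> \<sigma>" if "finite S" "S \<noteq> {}" "S \<subseteq> pprods n" for S
    using that
  proof (induction S rule: finite_ne_induct)
    case (singleton x)
    then show ?case using lin by (auto simp: order_on_defs refl_on_def)
  next
    case (insert x S)
    then obtain m where m: "m \<in> S" "\<forall>t\<in>S. (t, m) \<in> \<sigma>" by auto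
    have x: "(x, x) \<in> \<sigma>" "(x, m) \<in> \<sigma> \<or> (m, x) \<in> \<sigma>"
      using lin insert.prems m(1) unfolding order_on_defs total_on_def refl_on_def
      by (simp, metis insert_subset subsetD)
    then show ?case using m term_ordering_trans[OF \<sigma>] by blast
  qed
  then obtain m where m: "m \<in> Supp f" "\<forall>t\<in>Supp f. (t, m) \<in> \<sigma>"
    using f finite_keys by (metis empty_iff)
  then have "leading_term \<sigma> f = m"
    unfolding leading_term_def
    using term_ordering_antisym[OF \<sigma>] by (intro the_equality) auto
  then show ?thesis using m f(2) term_ordering_antisym[OF \<sigma>] by blast
qed

lemma irrelevant_ideal_Supp:
  assumes "f \<in> irrelevant_ideal n"
  shows "Supp f \<subseteq> pprods n"
proof -
  obtain g where f: "f = (\<Sum>j<n. g j * Poly_Mapping.single (indet j) 1)"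
    and g: "\<And>j. j < n \<Longrightarrow> g j \<in> polys n"
    using assms by (auto simp: irrelevant_ideal_def)
  have "Supp (\<Sum>j\<in>J. g j * Poly_Mapping.single (indet j) 1) \<subseteq> pprods n"
    if "finite J" "J \<subseteq> {..<n}" for J
    using that
  proof (induction J rule: finite_induct)
    case (insert j J)
    have "Supp (g j * Poly_Mapping.single (indet j) 1) \<subseteq> pprods n"
    proof
      fix t assume "t \<in> Supp (g j * Poly_Mapping.single (indet j) 1)"
      then obtain r where "r \<in> Supp (g j)" "t = r + indet j"
        using keys_mult[of "g j" "Poly_Mapping.single (indet j) 1"] by auto
      then show "t \<in> pprods n"
        using g[of j] insert.prems indet_in_pprods by (auto simp: polys_def intro: pprods_add)
    qed
    then show ?case
      using insert keys_add[of "g j * Poly_Mapping.single (indet j) 1"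
          "\<Sum>j\<in>J. g j * Poly_Mapping.single (indet j) 1"] by auto
  qed simp
  then show ?thesis by (simp add: f)
qed

lemma sum_exponent_vec_diff:
  "(\<Sum>j<n. w j * of_int ((exponent_vec n z - exponent_vec n t) $ j)) = weight n w z - weight n w t"
  by (simp add: exponent_vec_def weight_def sum_subtractf right_diff_distrib)

lemma separating_iff_weights:
  assumes F: "\<And>i. i < length Z \<Longrightarrow> Supp (F ! i) \<subseteq> pprods n"
    and Z: "\<And>i. i < length Z \<Longrightarrow> Z ! i \<in> Supp (F ! i)"
  shows "separating n Z F \<longleftrightarrow>
    (\<exists>w :: nat \<Rightarrow> rat. (\<forall>j<n. 1 \<le> w j) \<and> (\<forall>y\<in>DLog n Z F. 1 \<le> (\<Sum>j<n. w j * of_int (y $ j))))"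
    (is "_ \<longleftrightarrow> ?R")
proof
  assume "separating n Z F"
  then obtain \<sigma> where \<sigma>: "term_ordering n \<sigma>"
    and lt: "\<And>i. i < length Z \<Longrightarrow> leading_term \<sigma> (F ! i) = Z ! i"
    by (auto simp: separating_def)
  define R where "R = (\<Union>i<length Z. (\<lambda>t. (t, Z ! i)) ` (Supp (F ! i) - {Z ! i}))"
  have "R \<subseteq> \<sigma> - Id"
    using leading_term_eq_iff[OF \<sigma> F Z] lt by (auto simp: R_def)
  then obtain w where w: "\<forall>j<n. 1 \<le> w j" "\<forall>(t, t')\<in>R. 1 \<le> weight n w t' - weight n w t"
    using term_ordering_weights[OF \<sigma>, of R] by (auto simp: R_def)
  have "1 \<le> (\<Sum>j<n. w j * of_int (y $ j))" if y: "y \<in> DLog n Z F" for y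
  proof -
    obtain i t where "i < length Z" "t \<in> Supp (F ! i)" "t \<noteq> Z ! i"
      and y_eq: "y = exponent_vec n (Z ! i) - exponent_vec n t"
      using y by (auto simp: DLog_def DLog1_def)
    then have "(t, Z ! i) \<in> R" by (auto simp: R_def)
    then show ?thesis using w(2) unfolding y_eq sum_exponent_vec_diff by auto
  qed
  then show ?R using w(1) by blast
next
  assume ?R
  then obtain w :: "nat \<Rightarrow> rat" where w: "\<And>j. j < n \<Longrightarrow> 1 \<le> w j"
    and y: "\<And>y. y \<in> DLog n Z F \<Longrightarrow> 1 \<le> (\<Sum>j<n. w j * of_int (y $ j))" by blast
  have \<sigma>: "term_ordering n (weight_order n w)"
  proof (rule term_ordering_weight_order)
    show "0 < w j" if "j < n" for j using w[OF that] by linarith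
  qed
  have "leading_term (weight_order n w) (F ! i) = Z ! i" if i: "i < length Z" for i
  proof -
    have "(t, Z ! i) \<in> weight_order n w" if t: "t \<in> Supp (F ! i)" for t
    proof (cases "t = Z ! i")
      case True
      then show ?thesis using F[OF i] t by (auto simp: weight_order_def)
    next
      case False
      then have "exponent_vec n (Z ! i) - exponent_vec n t \<in> DLog n Z F"
        using i t by (auto simp: DLog_def DLog1_def)
      then have "1 \<le> weight n w (Z ! i) - weight n w t"
        using y unfolding sum_exponent_vec_diff[symmetric] by blast
      then show ?thesis using F[OF i] Z[OF i] t by (auto simp: weight_order_def)
    qed
    then show ?thesis using leading_term_eq_iff[OF \<sigma> F[OF i] Z[OF i]] by blast
  qed
  then show "separating n Z F" using \<sigma> by (auto simp: separating_def)
qed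

section \<open>The linear programme\<close>

lemma lp_solution_iff:
  fixes v :: "nat \<Rightarrow> int vec"
  assumes A: "A = mat k n (\<lambda>(i, j). - of_int (v i $ j))"
    and b: "b = vec k (\<lambda>i. (\<Sum>j<n. of_int (v i $ j)) - 1)"
  shows "lp_solution A b \<xi> \<longleftrightarrow> \<xi> \<in> carrier_vec n \<and> (\<forall>j<n. 1 \<le> \<xi> $ j + 1) \<and>
    (\<forall>y\<in>v ` {..<k}. 1 \<le> (\<Sum>j<n. (\<xi> $ j + 1) * of_int (y $ j)))"
proof (cases "\<xi> \<in> carrier_vec n")
  case True
  have "(A *\<^sub>v \<xi>) $ i \<le> b $ i \<longleftrightarrow> 1 \<le> (\<Sum>j<n. (\<xi> $ j + 1) * of_int (v i $ j))" if "i < k" for i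
  proof -
    have "(A *\<^sub>v \<xi>) $ i = - (\<Sum>j<n. \<xi> $ j * of_int (v i $ j))"
      using True that
      by (simp add: A scalar_prod_def sum_negf[symmetric] lessThan_atLeast0 mult.commute)
    moreover have "b $ i = (\<Sum>j<n. of_int (v i $ j)) - 1" using that by (simp add: b)
    ultimately show ?thesis by (simp add: algebra_simps sum.distrib) linarith
  qed
  moreover have "dim_vec b = k" "dim_row A = k" "dim_col A = n" by (simp_all add: A b)
  ultimately show ?thesis using True by (auto simp: lp_solution_def less_eq_vec_def)
qed (simp add: lp_solution_def A)

lemma common_denominator_clears:
  assumes "common_denominator d w" "i < dim_vec w"
  shows "\<exists>m :: int. of_int m = of_int d * w $ i"
proof -
  obtain p q where pq: "quotient_of (w $ i) = (p, q)" by force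
  then have "q dvd d" using assms by (auto simp: common_denominator_def)
  then obtain e where "d = q * e" by blast
  then have "of_int (p * e) = of_int d * w $ i"
    using quotient_of_div[OF pq] quotient_of_denom_pos[OF pq] by simp
  then show ?thesis by blast
qed

theorem corollary3p5:
  fixes n s k :: nat
    and Z :: "pprod list" and F :: "'a::field mpol list"
    and v :: "nat \<Rightarrow> int vec" and A :: "rat mat" and b :: "rat vec"
  assumes "1 \<le> s" and "s \<le> n"
    and "length Z = s" and "distinct Z" and "set Z \<subseteq> indet ` {..<n}"
    and "length F = s" and "set F \<subseteq> irrelevant_ideal n - {0}"
    and "\<forall>i<s. Z ! i \<in> Supp (F ! i)"
    and "DLog n Z F = v ` {..<k}"
    and "A = mat k n (\<lambda>(i, j). - of_int (v i $ j))"
    and "b = vec k (\<lambda>i. (\<Sum>j<n. of_int (v i $ j)) - 1)"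
  shows "(separating n Z F \<longleftrightarrow> (\<exists>\<xi>. lp_solution A b \<xi>)) \<and>
    (\<forall>\<xi> w d. lp_solution A b \<xi> \<longrightarrow> w = vec n (\<lambda>i. \<xi> $ i + 1) \<longrightarrow>
       (\<forall>i<n. w $ i > 0) \<and>
       (common_denominator d w \<longrightarrow>
          (\<exists>u\<in>carrier_vec n. (\<forall>i<n. u $ i > 0) \<and>
             map_vec of_int u = of_int d \<cdot>\<^sub>v w \<and>
             (\<forall>y\<in>DLog n Z F. u \<bullet> y > 0))))"
proof (intro conjI allI impI)
  have Supp_F: "Supp (F ! i) \<subseteq> pprods n" if "i < length Z" for i
    using assms(3,6,7) that nth_mem[of i F] by (intro irrelevant_ideal_Supp) (metis DiffD1 subsetD)
  note lp = lp_solution_iff[OF assms(10,11), folded assms(9)]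
  note sep = separating_iff_weights[of Z F n, OF Supp_F]
  show "separating n Z F \<longleftrightarrow> (\<exists>\<xi>. lp_solution A b \<xi>)"
  proof
    assume "separating n Z F"
    then obtain w :: "nat \<Rightarrow> rat" where w: "\<forall>j<n. 1 \<le> w j"
      "\<forall>y\<in>DLog n Z F. 1 \<le> (\<Sum>j<n. w j * of_int (y $ j))"
      using sep assms(3,8) by auto
    then have "lp_solution A b (vec n (\<lambda>j. w j - 1))" by (simp add: lp)
    then show "\<exists>\<xi>. lp_solution A b \<xi>" by blast
  next
    assume "\<exists>\<xi>. lp_solution A b \<xi>"
    then obtain \<xi> where \<xi>: "lp_solution A b \<xi>" by blast
    then have "\<exists>w :: nat \<Rightarrow> rat. (\<forall>j<n. 1 \<le> w j) \<and>
        (\<forall>y\<in>DLog n Z F. 1 \<le> (\<Sum>j<n. w j * of_int (y $ j)))"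
      unfolding lp by (intro exI[of _ "\<lambda>j. \<xi> $ j + 1"]) blast
    then show "separating n Z F" using sep assms(3,8) by auto
  qed
  fix \<xi> w d
  assume \<xi>: "lp_solution A b \<xi>" and w: "w = vec n (\<lambda>i. \<xi> $ i + 1)"
  show w_pos: "w $ i > 0" if "i < n" for i
    using \<xi> that by (auto simp: lp w)
  assume d: "common_denominator d w"
  have dim_w: "dim_vec w = n" by (simp add: w)
  have d_pos: "(of_int d :: rat) > 0" using d by (simp add: common_denominator_def)
  obtain m :: "nat \<Rightarrow> int" where m: "\<And>i. i < n \<Longrightarrow> of_int (m i) = of_int d * w $ i"
    using common_denominator_clears[OF d] unfolding dim_w by metis
  have "m i > 0" if "i < n" for i
    using m[OF that] w_pos[OF that] d_pos by (metis mult_pos_pos of_int_0_less_iff)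
  moreover have "map_vec of_int (vec n m) = of_int d \<cdot>\<^sub>v w"
    by (rule eq_vecI) (simp_all add: m dim_w)
  moreover have "vec n m \<bullet> y > 0" if y: "y \<in> DLog n Z F" for y
  proof -
    have "dim_vec y = n"
      using y by (auto simp: DLog_def DLog1_def exponent_vec_def)
    then have "of_int (vec n m \<bullet> y) = (\<Sum>j<n. of_int (m j) * (of_int (y $ j) :: rat))"
      by (simp add: scalar_prod_def lessThan_atLeast0)
    also have "\<dots> = of_int d * (\<Sum>j<n. (\<xi> $ j + 1) * of_int (y $ j))"
      by (simp add: m w sum_distrib_left mult.assoc)
    also have "\<dots> > 0"
    proof (rule mult_pos_pos[OF d_pos])
      have "1 \<le> (\<Sum>j<n. (\<xi> $ j + 1) * of_int (y $ j))" using \<xi> y by (auto simp: lp)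
      then show "0 < (\<Sum>j<n. (\<xi> $ j + 1) * of_int (y $ j))" by linarith
    qed
    finally show ?thesis by (simp only: of_int_0_less_iff)
  qed
  ultimately show "\<exists>u\<in>carrier_vec n. (\<forall>i<n. u $ i > 0) \<and>
             map_vec of_int u = of_int d \<cdot>\<^sub>v w \<and>
             (\<forall>y\<in>DLog n Z F. u \<bullet> y > 0)"
    by (intro bexI[of _ "vec n m"]) auto
qed

end
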